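(* Assume that the distribution $\mathbb{P}$ of $\xi$ is light-tailed, i.e., there exists $a>1$ such that $\mathbb{E}_{\mathbb{P}}\big[e^{\|\xi\|_{\mathrm{W}}^{a}}\big]<\infty$. Let $\beta\in(0,1)$. Then there exists $\epsilon=\epsilon(\beta)>0$ such that for all $h\in H$, $$\mathbb{P}\Big\{\mathbb{E}_{\mathbb{P}}\{c(\xi,h)\}\le \sup_{Q\in B_{\epsilon}(\widehat{\mathbb{P}})}\mathbb{E}_{Q}\{c(\xi,h)\}\Big\}\ge 1-\beta ,$$ where the outer probability is over the random measured sample $\hat\xi$, drawn from $\mathbb{P}$, which determines $\widehat{\mathbb{P}}=\delta_{\hat\xi}$.
   Context: System. Consider the stochastic LTI system $x(t+1)=Ax(t)+Bu(t)+Ev(t)$, $y(t)=Cx(t)+Du(t)+Fv(t)$, with $x(t)\in\mathbb{R}^n$, $u(t)\in\mathbb{R}^m$, $y(t)\in\mathbb{R}^p$, $v(t)\in\mathbb{R}^q$, real matrices of compatible sizes, $(A,B)$ controllable, $(A,C)$ observable, and $v(t)$ drawn from a probability distribution $\mathbb{P}_v$ for all $t\in\mathbb{Z}_{\ge 0}$. The lag $\ell$ is the smallest positive integer such that the matrix obtained by stacking $C,CA,\dots,CA^{\ell-1}$ has rank $n$. Hankel matrices. For a signal $w=(w(1),\dots,w(T))$ of vectors, $\mathscr{H}_L(w)$ is the block Hankel matrix with $L$ block rows and $T-L+1$ columns whose $(i,k)$ block is $w(i+k-1)$; $w$ is persistently exciting of order $L$ if $\mathscr{H}_L(w)$ has full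 row rank. Data. Let $T,T_{\mathrm{ini}},T_{\mathrm{f}}\in\mathbb{Z}_{>0}$ with $T_{\mathrm{ini}}\ge\ell$, and put $N:=T-T_{\mathrm{ini}}-T_{\mathrm{f}}+2$. The input data $\hat u\in\mathbb{R}^{mT}$ is persistently exciting of order $T_{\mathrm{ini}}+T_{\mathrm{f}}+n$. $\widehat U_{\mathrm{p}}$ and $\widehat U_{\mathrm{f}}$ are the first $T_{\mathrm{ini}}$ and the last $T_{\mathrm{f}}$ block rows of $\mathscr{H}_{T_{\mathrm{ini}}+T_{\mathrm{f}}}(\hat u)$. The measured outputs $\hat y\in\mathbb{R}^{pT}$ and $\hat y_{\mathrm{ini}}\in\mathbb{R}^{pT_{\mathrm{ini}}}$ (the $T_{\mathrm{ini}}$ most recent outputs) are viewed as realizations of random variables $y$ and $y_{\mathrm{ini}}$; $\hat u_{\mathrm{ini}}\in\mathbb{R}^{mT_{\mathrm{ini}}}$ is the vector of the $T_{\mathrm{ini}}$ most recent inputs (deterministic). $Y_{\mathrm{p}}$, $Y_{\mathrm{f}}$ denote the first $T_{\mathrm{ini}}$ and last $T_{\mathrm{f}}$ block rows of $\mathscr{H}_{T_{\mathrm{ini}}+T_{\mathrm{f}}}(y)$. Random rows. For $j\in\{1,\dots,p(T_{\mathrm{ini}}+T_{\mathrm{f}})\}$, $\xi_j$ is the $j$-th row of the random matrix $\begin{pmatrix} Y_{\mathrm{p}} & y_{\mathrm{ini}}\\ Y_{\mathrm{f}} & 0\end{pmatrix}$, with distribution $\mathbb{P}_j$ supported on $\Xi_j\subseteq\mathbb{R}^{N}$.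 Let $\xi$ be the stacked vector of all $\xi_j^T$; its distribution is taken to be the product $\mathbb{P}=\mathbb{P}_1\times\cdots\times\mathbb{P}_{p(T_{\mathrm{ini}}+T_{\mathrm{f}})}$, supported on $\Xi=\prod_j\Xi_j$. The measured realization of $\xi$ is $\hat\xi$, and $\widehat{\mathbb{P}}=\delta_{\hat\xi}$ is the Dirac distribution at $\hat\xi$. Optimization. Let $\mathcal{U}\subset\mathbb{R}^{mT_{\mathrm{f}}}$ be an input constraint set, $f:\mathbb{R}^{mT_{\mathrm{f}}}\times\mathbb{R}^{pT_{\mathrm{f}}}\to\mathbb{R}$ an objective function, and $\lambda_{\mathrm{ini}}\ge 0$. Define $$H=\{h=(g^T,-1)^T \mid g\in\mathbb{R}^{N-1},\ \widehat U_{\mathrm{p}}g=\hat u_{\mathrm{ini}},\ \widehat U_{\mathrm{f}}g\in\mathcal{U}\},$$ $$c(\xi,h)=f\big((\widehat U_{\mathrm{f}},0)h,(\xi_{pT_{\mathrm{ini}}+1}h,\dots,\xi_{p(T_{\mathrm{ini}}+T_{\mathrm{f}})}h)\big)+\lambda_{\mathrm{ini}}\|(\xi_1h,\dots,\xi_{pT_{\mathrm{ini}}}h)\|_1 .$$ Expectations that are written are implicitly understood to be well defined. Wasserstein ball. $\|\cdot\|_{\mathrm{W}}$ is an arbitrary norm on the space containing $\Xi$. $\mathcal{M}(\Xi)$ is the set of probability distributions $Q$ supported on $\Xi$ with $\mathbb{E}_Q[\|\xi\|_{\mathrm{W}}]<\infty$. For $Q_1,Q_2\in\mathcal{M}(\Xi)$,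 $d_{\mathrm{W}}(Q_1,Q_2)=\inf_{\Pi}\int_{\Xi^2}\|\xi_1-\xi_2\|_{\mathrm{W}}\,\Pi(d\xi_1,d\xi_2)$ over joint distributions $\Pi$ with marginals $Q_1,Q_2$. $B_\epsilon(Q)=\{Q'\in\mathcal{M}(\Xi)\mid d_{\mathrm{W}}(Q,Q')\le\epsilon\}$. *)

theory Defs
  imports "HOL-Probability.Probability" "Jordan_Normal_Form.DL_Rank"
begin

text \<open>Vectors and matrices are those of \<open>Jordan_Normal_Form.Matrix\<close>, whose dimensions are natural
  numbers. A signal is a function of the time \<open>t = 1, 2, \<dots>\<close>, whereas entries of vectors and
  matrices are indexed from 0.\<close>

section \<open>Linear systems\<close>

definition controllable :: "nat \<Rightarrow> nat \<Rightarrow> real Matrix.mat \<Rightarrow> real Matrix.mat \<Rightarrow> bool" where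
  "controllable n m A B \<longleftrightarrow>
     vec_space.rank n
       (Matrix.mat n (n * m) (\<lambda>(i, j). (A ^\<^sub>m (j div m) * B) $$ (i, j mod m))) = n"

definition observability_matrix ::
  "nat \<Rightarrow> nat \<Rightarrow> nat \<Rightarrow> real Matrix.mat \<Rightarrow> real Matrix.mat \<Rightarrow> real Matrix.mat" where
  "observability_matrix n p l A C =
     Matrix.mat (l * p) n (\<lambda>(i, j). (C * A ^\<^sub>m (i div p)) $$ (i mod p, j))"

definition observable :: "nat \<Rightarrow> nat \<Rightarrow> real Matrix.mat \<Rightarrow> real Matrix.mat \<Rightarrow> bool" where
  "observable n p A C \<longleftrightarrow> vec_space.rank (n * p) (observability_matrix n p n A C) = n"

definition lag :: "nat \<Rightarrow> nat \<Rightarrow> real Matrix.mat \<Rightarrow> real Matrix.mat \<Rightarrow> nat" where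
  "lag n p A C =
     (LEAST l. 0 < l \<and> vec_space.rank (l * p) (observability_matrix n p l A C) = n)"

section \<open>Stacked signals and Hankel matrices\<close>

definition stack :: "nat \<Rightarrow> nat \<Rightarrow> (nat \<Rightarrow> real Matrix.vec) \<Rightarrow> real Matrix.vec" where
  "stack d L w = Matrix.vec (L * d) (\<lambda>i. vec_index (w (i div d + 1)) (i mod d))"

definition hankel :: "nat \<Rightarrow> nat \<Rightarrow> nat \<Rightarrow> (nat \<Rightarrow> real Matrix.vec) \<Rightarrow> real Matrix.mat" where
  "hankel d L T w =
     Matrix.mat (L * d) (T + 1 - L) (\<lambda>(i, k). vec_index (w (i div d + k + 1)) (i mod d))"

definition persistently_exciting ::
  "nat \<Rightarrow> nat \<Rightarrow> nat \<Rightarrow> (nat \<Rightarrow> real Matrix.vec) \<Rightarrow> bool" where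
  "persistently_exciting d L T w \<longleftrightarrow> vec_space.rank (L * d) (hankel d L T w) = L * d"

definition hankel_past ::
  "nat \<Rightarrow> nat \<Rightarrow> nat \<Rightarrow> nat \<Rightarrow> (nat \<Rightarrow> real Matrix.vec) \<Rightarrow> real Matrix.mat" where
  "hankel_past d Tini Tf T w =
     Matrix.mat (Tini * d) (T + 1 - (Tini + Tf)) (\<lambda>(i, k). hankel d (Tini + Tf) T w $$ (i, k))"

definition hankel_future ::
  "nat \<Rightarrow> nat \<Rightarrow> nat \<Rightarrow> nat \<Rightarrow> (nat \<Rightarrow> real Matrix.vec) \<Rightarrow> real Matrix.mat" where
  "hankel_future d Tini Tf T w =
     Matrix.mat (Tf * d) (T + 1 - (Tini + Tf))
       (\<lambda>(i, k). hankel d (Tini + Tf) T w $$ (Tini * d + i, k))"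

definition data_matrix ::
  "nat \<Rightarrow> nat \<Rightarrow> nat \<Rightarrow> nat \<Rightarrow> (nat \<Rightarrow> real Matrix.vec) \<Rightarrow> (nat \<Rightarrow> real Matrix.vec) \<Rightarrow>
     real Matrix.mat" where
  "data_matrix p Tini Tf T y yini =
     four_block_mat (hankel_past p Tini Tf T y) (mat_of_cols (Tini * p) [stack p Tini yini])
       (hankel_future p Tini Tf T y) (0\<^sub>m (Tf * p) 1)"

section \<open>Random vectors\<close>

text \<open>The Borel sigma-algebra of \<open>\<real>\<^sup>d\<close>, that is, the one generated by the coordinates.\<close>

definition vec_borel :: "nat \<Rightarrow> real Matrix.vec measure" where
  "vec_borel d =
     vimage_algebra (carrier_vec d) (\<lambda>x. \<lambda>i\<in>{..<d}. vec_index x i) (\<Pi>\<^sub>M i\<in>{..<d}. borel)"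

text \<open>The signals \<open>x\<close>, \<open>v\<close>, \<open>y\<close> are random, the input \<open>u\<close> is deterministic. No dependence
  structure is imposed on the noise.\<close>

definition stochastic_trajectory ::
  "'w measure \<Rightarrow> nat \<Rightarrow> nat \<Rightarrow> nat \<Rightarrow> nat \<Rightarrow> real Matrix.mat \<Rightarrow> real Matrix.mat \<Rightarrow> real Matrix.mat \<Rightarrow>
     real Matrix.mat \<Rightarrow> real Matrix.mat \<Rightarrow> real Matrix.mat \<Rightarrow> real Matrix.vec measure \<Rightarrow> nat \<Rightarrow>
     (nat \<Rightarrow> real Matrix.vec) \<Rightarrow> (nat \<Rightarrow> 'w \<Rightarrow> real Matrix.vec) \<Rightarrow>
     (nat \<Rightarrow> 'w \<Rightarrow> real Matrix.vec) \<Rightarrow> (nat \<Rightarrow> 'w \<Rightarrow> real Matrix.vec) \<Rightarrow> bool" where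
  "stochastic_trajectory M n m p q A B C D E F Pv L u x v y \<longleftrightarrow>
     (\<forall>t\<in>{1..L}.
        u t \<in> carrier_vec m \<and>
        x t \<in> measurable M (vec_borel n) \<and>
        v t \<in> measurable M (vec_borel q) \<and> distr M (vec_borel q) (v t) = Pv \<and>
        y t \<in> measurable M (vec_borel p) \<and>
        (\<forall>\<omega>\<in>space M. y t \<omega> = C *\<^sub>v x t \<omega> + D *\<^sub>v u t + F *\<^sub>v v t \<omega>)) \<and>
     (\<forall>t\<in>{1..<L}. \<forall>\<omega>\<in>space M. x (t + 1) \<omega> = A *\<^sub>v x t \<omega> + B *\<^sub>v u t + E *\<^sub>v v t \<omega>)"

definition supported_on :: "'a measure \<Rightarrow> 'a set \<Rightarrow> bool" where
  "supported_on Q S \<longleftrightarrow> S \<in> sets Q \<and> emeasure Q S = 1"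

definition row_distribution ::
  "'w measure \<Rightarrow> nat \<Rightarrow> nat \<Rightarrow> nat \<Rightarrow> nat \<Rightarrow> nat \<Rightarrow>
     (nat \<Rightarrow> 'w \<Rightarrow> real Matrix.vec) \<Rightarrow> (nat \<Rightarrow> 'w \<Rightarrow> real Matrix.vec) \<Rightarrow> nat \<Rightarrow>
     real Matrix.vec measure" where
  "row_distribution M N p Tini Tf T y yini j =
     distr M (vec_borel N)
       (\<lambda>\<omega>. Matrix.row (data_matrix p Tini Tf T (\<lambda>t. y t \<omega>) (\<lambda>t. yini t \<omega>)) j)"

text \<open>\<open>row_block N \<xi> j\<close> is the \<open>j\<close>-th of the rows of length \<open>N\<close> stacked in \<open>\<xi>\<close>.\<close>

definition row_block :: "nat \<Rightarrow> real Matrix.vec \<Rightarrow> nat \<Rightarrow> real Matrix.vec" where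
  "row_block N \<xi> j = Matrix.vec N (\<lambda>k. vec_index \<xi> (j * N + k))"

definition product_support ::
  "nat \<Rightarrow> nat \<Rightarrow> (nat \<Rightarrow> real Matrix.vec set) \<Rightarrow> real Matrix.vec set" where
  "product_support R N \<Xi> = {\<xi> \<in> carrier_vec (R * N). \<forall>j<R. row_block N \<xi> j \<in> \<Xi> j}"

text \<open>The rows of a Hankel matrix share entries, so in general the product of the row distributions is
  not the joint distribution of the rows. It is the distribution that \<open>\<xi>\<close> is taken to have.\<close>

definition product_distribution ::
  "nat \<Rightarrow> nat \<Rightarrow> (nat \<Rightarrow> real Matrix.vec measure) \<Rightarrow> real Matrix.vec measure" where
  "product_distribution R N P =
     distr (\<Pi>\<^sub>M j\<in>{..<R}. P j) (vec_borel (R * N))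
       (\<lambda>r. Matrix.vec (R * N) (\<lambda>i. vec_index (r (i div N)) (i mod N)))"

text \<open>Expectations are taken in the extended reals; they are undefined when the positive and the
  negative part both have infinite integral.\<close>

definition expectation_defined :: "'a measure \<Rightarrow> ('a \<Rightarrow> real) \<Rightarrow> bool" where
  "expectation_defined Q g \<longleftrightarrow> g \<in> borel_measurable Q \<and>
     ((\<integral>\<^sup>+ x. ennreal (g x) \<partial>Q) < \<infinity> \<or> (\<integral>\<^sup>+ x. ennreal (- g x) \<partial>Q) < \<infinity>)"

definition ext_expectation :: "'a measure \<Rightarrow> ('a \<Rightarrow> real) \<Rightarrow> ereal" where
  "ext_expectation Q g =
     enn2ereal (\<integral>\<^sup>+ x. ennreal (g x) \<partial>Q) - enn2ereal (\<integral>\<^sup>+ x. ennreal (- g x) \<partial>Q)"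

lemma ext_expectation_integrable:
  assumes "integrable Q g"
  shows "expectation_defined Q g" and "ext_expectation Q g = ereal (integral\<^sup>L Q g)"
proof -
  have m: "g \<in> borel_measurable Q" using assms by simp
  have fin: "(\<integral>\<^sup>+ x. ennreal (g x) \<partial>Q) < \<infinity>" "(\<integral>\<^sup>+ x. ennreal (- g x) \<partial>Q) < \<infinity>"
    using assms unfolding real_integrable_def by (auto simp: top.not_eq_extremum)
  show "expectation_defined Q g" using m fin unfolding expectation_defined_def by simp
  obtain a where a: "(\<integral>\<^sup>+ x. ennreal (g x) \<partial>Q) = ennreal a" "0 \<le> a"
    using fin(1) by (cases "\<integral>\<^sup>+ x. ennreal (g x) \<partial>Q") auto
  obtain b where b: "(\<integral>\<^sup>+ x. ennreal (- g x) \<partial>Q) = ennreal b" "0 \<le> b"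
    using fin(2) by (cases "\<integral>\<^sup>+ x. ennreal (- g x) \<partial>Q") auto
  show "ext_expectation Q g = ereal (integral\<^sup>L Q g)"
    unfolding ext_expectation_def real_lebesgue_integral_def[OF assms] using a b
    by (simp add: enn2ereal_ennreal)
qed

section \<open>Wasserstein balls\<close>

definition is_vec_norm :: "nat \<Rightarrow> (real Matrix.vec \<Rightarrow> real) \<Rightarrow> bool" where
  "is_vec_norm d nrm \<longleftrightarrow>
     (\<forall>x\<in>carrier_vec d. 0 \<le> nrm x \<and> (nrm x = 0 \<longleftrightarrow> x = 0\<^sub>v d)) \<and>
     (\<forall>x\<in>carrier_vec d. \<forall>a. nrm (a \<cdot>\<^sub>v x) = \<bar>a\<bar> * nrm x) \<and>
     (\<forall>x\<in>carrier_vec d. \<forall>y\<in>carrier_vec d. nrm (x + y) \<le> nrm x + nrm y)"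

definition finite_moment_distributions ::
  "nat \<Rightarrow> (real Matrix.vec \<Rightarrow> real) \<Rightarrow> real Matrix.vec set \<Rightarrow> real Matrix.vec measure set" where
  "finite_moment_distributions d nrm S =
     {Q. prob_space Q \<and> sets Q = sets (vec_borel d) \<and> supported_on Q S \<and>
         (\<integral>\<^sup>+ \<xi>. ennreal (nrm \<xi>) \<partial>Q) < \<infinity>}"

definition couplings ::
  "nat \<Rightarrow> real Matrix.vec measure \<Rightarrow> real Matrix.vec measure \<Rightarrow>
     (real Matrix.vec \<times> real Matrix.vec) measure set" where
  "couplings d Q1 Q2 =
     {\<gamma>. sets \<gamma> = sets (vec_borel d \<Otimes>\<^sub>M vec_borel d) \<and>
         distr \<gamma> (vec_borel d) fst = Q1 \<and> distr \<gamma> (vec_borel d) snd = Q2}"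

definition wasserstein ::
  "nat \<Rightarrow> (real Matrix.vec \<Rightarrow> real) \<Rightarrow> real Matrix.vec set \<Rightarrow>
     real Matrix.vec measure \<Rightarrow> real Matrix.vec measure \<Rightarrow> ennreal" where
  "wasserstein d nrm S Q1 Q2 =
     (INF \<gamma> \<in> couplings d Q1 Q2. \<integral>\<^sup>+ z \<in> S \<times> S. ennreal (nrm (fst z - snd z)) \<partial>\<gamma>)"

definition wasserstein_ball ::
  "nat \<Rightarrow> (real Matrix.vec \<Rightarrow> real) \<Rightarrow> real Matrix.vec set \<Rightarrow> real \<Rightarrow>
     real Matrix.vec measure \<Rightarrow> real Matrix.vec measure set" where
  "wasserstein_ball d nrm S \<epsilon> Q =
     {Q' \<in> finite_moment_distributions d nrm S. wasserstein d nrm S Q Q' \<le> ennreal \<epsilon>}"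

section \<open>Decision variables and cost\<close>

definition decision_set ::
  "nat \<Rightarrow> real Matrix.mat \<Rightarrow> real Matrix.mat \<Rightarrow> real Matrix.vec \<Rightarrow> real Matrix.vec set \<Rightarrow>
     real Matrix.vec set" where
  "decision_set N Up Uf uini U =
     {g @\<^sub>v vec_of_list [- 1] |g. g \<in> carrier_vec (N - 1) \<and> Up *\<^sub>v g = uini \<and> Uf *\<^sub>v g \<in> U}"

definition append_zero_col :: "real Matrix.mat \<Rightarrow> real Matrix.mat" where
  "append_zero_col A =
     four_block_mat A (0\<^sub>m (dim_row A) 1) (0\<^sub>m 0 (dim_col A)) (0\<^sub>m 0 1)"

definition l1_norm :: "real Matrix.vec \<Rightarrow> real" where
  "l1_norm x = (\<Sum>i<dim_vec x. \<bar>vec_index x i\<bar>)"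

definition cost ::
  "(real Matrix.vec \<Rightarrow> real Matrix.vec \<Rightarrow> real) \<Rightarrow> real \<Rightarrow> nat \<Rightarrow> nat \<Rightarrow> nat \<Rightarrow> nat \<Rightarrow>
     real Matrix.mat \<Rightarrow> real Matrix.vec \<Rightarrow> real Matrix.vec \<Rightarrow> real" where
  "cost f lam N p Tini Tf Uf \<xi> h =
     f (append_zero_col Uf *\<^sub>v h)
       (Matrix.vec (Tf * p) (\<lambda>i. row_block N \<xi> (Tini * p + i) \<bullet> h))
     + lam * l1_norm (Matrix.vec (Tini * p) (\<lambda>i. row_block N \<xi> i \<bullet> h))"

end

theory Submission
  imports Defs
begin

text \<open>Since \<open>P\<close> has a finite first moment, the distance from \<open>\<delta>\<^sub>x\<close> to \<open>P\<close>, which is the mean of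
  \<open>\<parallel>x - \<xi>\<parallel>\<close> under \<open>P\<close>, is at most \<open>\<parallel>x\<parallel> + E\<parallel>\<xi>\<parallel>\<close>. By Markov's inequality \<open>\<parallel>x\<parallel>\<close> is bounded by a constant
  outside an event of probability \<open>\<beta>\<close>, so for a suitable radius \<open>P\<close> itself lies in the ball around
  \<open>\<delta>\<^sub>x\<close> with probability at least \<open>1 - \<beta>\<close>, whatever the decision \<open>h\<close>. The event in the theorem must
  also be measurable, because \<open>measure\<close> is 0 on non-measurable sets. The cost is merely Borel in
  \<open>\<xi>\<close>, but the supremum over the ball is lower semicontinuous in the centre.\<close>

section \<open>The Borel sigma-algebra of vectors\<close>

lemma space_vec_borel [simp]: "space (vec_borel d) = carrier_vec d"
  by (simp add: vec_borel_def)

lemma measurable_vec_index [measurable]: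
  assumes "i < d"
  shows "(\<lambda>x. vec_index x i) \<in> borel_measurable (vec_borel d)"
proof -
  have "(\<lambda>x. \<lambda>i\<in>{..<d}. vec_index x i) \<in> measurable (vec_borel d) (\<Pi>\<^sub>M i\<in>{..<d}. borel)"
    unfolding vec_borel_def by (rule measurable_vimage_algebra1) (auto simp: space_PiM)
  then have "(\<lambda>x. (\<lambda>i\<in>{..<d}. vec_index x i) i) \<in> borel_measurable (vec_borel d)"
    by (rule measurable_compose[OF _ measurable_component_singleton]) (use assms in simp)
  then show ?thesis
    using assms by simp
qed

lemma measurable_vec_borelI:
  assumes "\<And>x. x \<in> space M \<Longrightarrow> g x \<in> carrier_vec d"
    and "\<And>i. i < d \<Longrightarrow> (\<lambda>x. vec_index (g x) i) \<in> borel_measurable M"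
  shows "g \<in> measurable M (vec_borel d)"
  unfolding vec_borel_def
  by (rule measurable_vimage_algebra2) (use assms in \<open>auto intro!: measurable_restrict\<close>)

text \<open>The countable base of \<open>l1\<close> balls with rational centres and radii does the
  work: a relatively open \<open>V\<close> is the union of the sets
  \<open>S \<inter> ball (q, r)\<close> that it contains. Openness is spelled out through the
  \<open>l1\<close> distance, and only relative to \<open>S\<close>, since the function studied
  later is controlled only on the support.\<close>

lemma sets_vec_borel_relatively_open:
  assumes S: "S \<in> sets (vec_borel d)" and VS: "V \<subseteq> S"
    and open_at: "\<And>x. x \<in> V \<Longrightarrow>
      \<exists>r>0. \<forall>y\<in>S. (\<Sum>i<d. \<bar>vec_index y i - vec_index x i\<bar>) < r \<longrightarrow> y \<in> V"
  shows "V \<in> sets (vec_borel d)"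
proof -
  define ball where "ball = (\<lambda>(q :: real list, r).
    {y \<in> carrier_vec d. (\<Sum>i<d. \<bar>vec_index y i - q ! i\<bar>) < r})"
  \<comment> \<open>\<open>I\<close> indexes the rational balls whose trace on \<open>S\<close> lies
    in \<open>V\<close>. It is countable, so the union over it is measurable.\<close>
  define I where "I = {qr \<in> {q. set q \<subseteq> \<rat> \<and> length q = d} \<times> \<rat>. S \<inter> ball qr \<subseteq> V}"
  have Sc: "S \<subseteq> carrier_vec d"
    using sets.sets_into_space[OF S] by simp
  have "countable {q. set q \<subseteq> (\<rat> :: real set) \<and> length q = d}"
    by (rule countable_subset[OF _ countable_lists[OF countable_rat]]) auto
  then have I: "countable I"
    unfolding I_def by (intro countable_subset[OF Collect_restrict] countable_SIGMA countable_rat)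
  have "ball qr \<in> sets (vec_borel d)" for qr
  proof -
    have "{y \<in> space (vec_borel d). (\<Sum>i<d. \<bar>vec_index y i - fst qr ! i\<bar>) < snd qr}
        \<in> sets (vec_borel d)"
      by measurable
    then show ?thesis
      by (simp add: ball_def split_beta)
  qed
  then have "S \<inter> (\<Union>qr\<in>I. ball qr) \<in> sets (vec_borel d)"
    using S I by (intro sets.Int sets.countable_UN') auto
  moreover have "V = S \<inter> (\<Union>qr\<in>I. ball qr)"
  proof (intro equalityI subsetI IntI)
    fix x assume x: "x \<in> V"
    then obtain r where r: "r > 0" "\<And>y. y \<in> S \<Longrightarrow>
        (\<Sum>i<d. \<bar>vec_index y i - vec_index x i\<bar>) < r \<Longrightarrow> y \<in> V"
      using open_at by blast
    \<comment> \<open>With \<open>s\<close> below \<open>r / 2\<close>, a point of the ball around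
      \<open>q\<close> is closer than \<open>r\<close> to \<open>x\<close>, as both lie within
      \<open>s\<close> of \<open>q\<close>.\<close>
    obtain s where s: "s \<in> \<rat>" "0 < s" "s < r / 2"
      using Rats_dense_in_real[of 0 "r / 2"] r(1) by auto
    \<comment> \<open>The denominator \<open>real d + 1\<close> keeps the sum of the
      \<open>d\<close> coordinate errors strictly below \<open>s\<close> and is nonzero even for
      \<open>d = 0\<close>.\<close>
    have "\<exists>a\<in>\<rat>. \<bar>vec_index x i - a\<bar> < s / (real d + 1)" for i
    proof -
      have "0 < s / (real d + 1)"
        using s by simp
      then obtain a where "a \<in> \<rat>" "vec_index x i < a" "a < vec_index x i + s / (real d + 1)"
        using Rats_dense_in_real[of "vec_index x i" "vec_index x i + s / (real d + 1)"] by auto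
      then show ?thesis
        by (intro bexI[of _ a]) auto
    qed
    then obtain a where a: "\<And>i. a i \<in> \<rat>" "\<And>i. \<bar>vec_index x i - a i\<bar> < s / (real d + 1)"
      by metis
    define q where "q = map a [0..<d]"
    have "(\<Sum>i<d. \<bar>vec_index x i - q ! i\<bar>) \<le> (\<Sum>i<d. s / (real d + 1))"
      using a(2) by (intro sum_mono) (auto simp: q_def less_imp_le)
    also have "\<dots> < s"
      using s(2) by (simp add: field_simps)
    finally have xq: "(\<Sum>i<d. \<bar>vec_index x i - q ! i\<bar>) < s" .
    have "S \<inter> ball (q, s) \<subseteq> V"
    proof
      fix y assume "y \<in> S \<inter> ball (q, s)"
      then have y: "y \<in> S" "(\<Sum>i<d. \<bar>vec_index y i - q ! i\<bar>) < s"
        by (auto simp: ball_def)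
      have "(\<Sum>i<d. \<bar>vec_index y i - vec_index x i\<bar>)
          \<le> (\<Sum>i<d. \<bar>vec_index y i - q ! i\<bar> + \<bar>vec_index x i - q ! i\<bar>)"
        by (intro sum_mono) auto
      also have "\<dots> < r"
        using y(2) xq s(3) by (simp add: sum.distrib)
      finally show "y \<in> V"
        using r(2) y(1) by blast
    qed
    moreover have "set q \<subseteq> \<rat>" "length q = d"
      using a(1) by (auto simp: q_def)
    ultimately have "(q, s) \<in> I"
      using s(1) by (simp add: I_def)
    moreover have "x \<in> ball (q, s)"
      using xq x VS Sc by (auto simp: ball_def)
    ultimately show "x \<in> (\<Union>qr\<in>I. ball qr)"
      by blast
  next
    fix x assume "x \<in> V"
    then show "x \<in> S"
      using VS by blast
  next
    fix x assume "x \<in> S \<inter> (\<Union>qr\<in>I. ball qr)"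
    then show "x \<in> V"
      by (auto simp: I_def)
  qed
  ultimately show ?thesis
    by simp
qed

section \<open>Norms on vectors\<close>

lemma
  assumes "is_vec_norm d nrm"
  shows vec_norm_nonneg: "x \<in> carrier_vec d \<Longrightarrow> 0 \<le> nrm x"
    and vec_norm_zero: "nrm (0\<^sub>v d) = 0"
    and vec_norm_smult: "x \<in> carrier_vec d \<Longrightarrow> nrm (a \<cdot>\<^sub>v x) = \<bar>a\<bar> * nrm x"
    and vec_norm_triangle:
      "x \<in> carrier_vec d \<Longrightarrow> y \<in> carrier_vec d \<Longrightarrow> nrm (x + y) \<le> nrm x + nrm y"
  using assms unfolding is_vec_norm_def by auto

lemma vec_norm_minus_commute:
  assumes "is_vec_norm d nrm" "x \<in> carrier_vec d" "y \<in> carrier_vec d"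
  shows "nrm (x - y) = nrm (y - x)"
proof -
  have "x - y = (- 1) \<cdot>\<^sub>v (y - x)"
    using assms(2,3) by (intro eq_vecI) auto
  then show ?thesis
    using vec_norm_smult[OF assms(1), of "y - x" "- 1"] assms(2,3) by simp
qed

lemma vec_norm_dist_triangle:
  assumes "is_vec_norm d nrm" "x \<in> carrier_vec d" "y \<in> carrier_vec d" "z \<in> carrier_vec d"
  shows "nrm (x - z) \<le> nrm (x - y) + nrm (y - z)"
proof -
  have "x - z = (x - y) + (y - z)"
    using assms(2-4) by (intro eq_vecI) auto
  then show ?thesis
    using vec_norm_triangle[OF assms(1), of "x - y" "y - z"] assms(2-4) by simp
qed

lemma vec_norm_diff_le:
  assumes "is_vec_norm d nrm" "x \<in> carrier_vec d" "y \<in> carrier_vec d"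
  shows "nrm (x - y) \<le> nrm x + nrm y"
proof -
  have "x - 0\<^sub>v d = x" "0\<^sub>v d - y = (- 1) \<cdot>\<^sub>v y"
    using assms(2,3) by auto
  then show ?thesis
    using vec_norm_dist_triangle[OF assms(1,2) zero_carrier_vec assms(3)]
      vec_norm_smult[OF assms(1,3), of "- 1"] by simp
qed

text \<open>Expand \<open>x\<close> in the unit vectors and apply the triangle inequality. This half
  of the equivalence of norms makes every set that is open for \<open>nrm\<close> open for the
  \<open>l1\<close> distance.\<close>

lemma vec_norm_le_l1:
  assumes nrm: "is_vec_norm d nrm"
  obtains K where "0 < K"
    "\<And>x. x \<in> carrier_vec d \<Longrightarrow> nrm x \<le> K * (\<Sum>i<d. \<bar>vec_index x i\<bar>)"
proof
  \<comment> \<open>The summand 1 makes the constant positive also for \<open>d = 0\<close>.\<close>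
  let ?K = "1 + (\<Sum>i<d. nrm (unit_vec d i))"
  have nn: "0 \<le> nrm (unit_vec d i)" for i
    by (rule vec_norm_nonneg[OF nrm]) simp
  show "0 < ?K"
    using sum_nonneg[of "{..<d}" "\<lambda>i. nrm (unit_vec d i)"] nn by simp
  show "nrm x \<le> ?K * (\<Sum>i<d. \<bar>vec_index x i\<bar>)" if x: "x \<in> carrier_vec d" for x
  proof -
    \<comment> \<open>Truncation of \<open>x\<close> to its first \<open>k\<close> entries; the
      induction adds one coordinate at a time.\<close>
    let ?t = "\<lambda>k. Matrix.vec d (\<lambda>i. if i < k then vec_index x i else 0)"
    have "nrm (?t k) \<le> (\<Sum>i<k. \<bar>vec_index x i\<bar> * nrm (unit_vec d i))" if "k \<le> d" for k
      using that
    proof (induction k)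
      case 0
      have "?t 0 = 0\<^sub>v d"
        by (intro eq_vecI) auto
      then show ?case
        using vec_norm_zero[OF nrm] by simp
    next
      case (Suc k)
      have "?t (Suc k) = ?t k + vec_index x k \<cdot>\<^sub>v unit_vec d k"
        using Suc.prems by (intro eq_vecI) (auto simp: less_Suc_eq)
      then have "nrm (?t (Suc k)) \<le> nrm (?t k) + nrm (vec_index x k \<cdot>\<^sub>v unit_vec d k)"
        using vec_norm_triangle[OF nrm, of "?t k" "vec_index x k \<cdot>\<^sub>v unit_vec d k"] by simp
      also have "nrm (vec_index x k \<cdot>\<^sub>v unit_vec d k) = \<bar>vec_index x k\<bar> * nrm (unit_vec d k)"
        by (rule vec_norm_smult[OF nrm]) simp
      finally show ?case
        using Suc by simp
    qed
    from this[of d] have "nrm (?t d) \<le> (\<Sum>i<d. \<bar>vec_index x i\<bar> * nrm (unit_vec d i))"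
      by simp
    moreover have "?t d = x"
      using x by (intro eq_vecI) auto
    ultimately have "nrm x \<le> (\<Sum>i<d. \<bar>vec_index x i\<bar> * nrm (unit_vec d i))"
      by simp
    also have "\<dots> \<le> (\<Sum>i<d. \<bar>vec_index x i\<bar> * ?K)"
    proof (intro sum_mono mult_left_mono)
      fix i assume "i \<in> {..<d}"
      then have "nrm (unit_vec d i) \<le> (\<Sum>i<d. nrm (unit_vec d i))"
        using nn by (intro member_le_sum) auto
      then show "nrm (unit_vec d i) \<le> ?K"
        by simp
    qed simp
    finally show ?thesis
      by (simp add: sum_distrib_right[symmetric] mult.commute)
  qed
qed

lemma sets_vec_borel_relatively_norm_open:
  assumes nrm: "is_vec_norm d nrm" and S: "S \<in> sets (vec_borel d)" and VS: "V \<subseteq> S"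
    and open_at: "\<And>x. x \<in> V \<Longrightarrow> \<exists>r>0. \<forall>y\<in>S. nrm (y - x) < r \<longrightarrow> y \<in> V"
  shows "V \<in> sets (vec_borel d)"
proof (rule sets_vec_borel_relatively_open[OF S VS])
  fix x assume x: "x \<in> V"
  have Sc: "S \<subseteq> carrier_vec d"
    using sets.sets_into_space[OF S] by simp
  obtain K where K: "0 < K" "\<And>x. x \<in> carrier_vec d \<Longrightarrow> nrm x \<le> K * (\<Sum>i<d. \<bar>vec_index x i\<bar>)"
    using vec_norm_le_l1[OF nrm] by blast
  obtain r where r: "r > 0" "\<And>y. y \<in> S \<Longrightarrow> nrm (y - x) < r \<Longrightarrow> y \<in> V"
    using open_at[OF x] by blast
  \<comment> \<open>The \<open>l1\<close> radius \<open>r / K\<close> forces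
    \<open>nrm (y - x) < r\<close>.\<close>
  have "y \<in> V" if y: "y \<in> S" "(\<Sum>i<d. \<bar>vec_index y i - vec_index x i\<bar>) < r / K" for y
  proof (rule r(2)[OF y(1)])
    have "y \<in> carrier_vec d" "x \<in> carrier_vec d"
      using x y VS Sc by auto
    then have "nrm (y - x) \<le> K * (\<Sum>i<d. \<bar>vec_index y i - vec_index x i\<bar>)"
      using K(2)[of "y - x"] by simp
    also have "\<dots> < r"
      using y(2) K(1) by (simp add: field_simps)
    finally show "nrm (y - x) < r" .
  qed
  then show "\<exists>r>0. \<forall>y\<in>S. (\<Sum>i<d. \<bar>vec_index y i - vec_index x i\<bar>) < r \<longrightarrow> y \<in> V"
    using divide_pos_pos[OF r(1) K(1)] by blast
qed

text \<open>By the triangle inequality, strict superlevel sets of the norm are open: around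
  \<open>x\<close> the radius \<open>nrm x - a\<close> works.\<close>

lemma measurable_vec_norm:
  assumes nrm: "is_vec_norm d nrm"
  shows "nrm \<in> borel_measurable (vec_borel d)"
proof (rule borel_measurableI_greater)
  fix a
  show "{x \<in> space (vec_borel d). a < nrm x} \<in> sets (vec_borel d)"
  proof (rule sets_vec_borel_relatively_norm_open[OF nrm sets.top])
    fix x assume "x \<in> {x \<in> space (vec_borel d). a < nrm x}"
    then have x: "x \<in> carrier_vec d" "a < nrm x"
      by auto
    have "a < nrm y" if y: "y \<in> carrier_vec d" "nrm (y - x) < nrm x - a" for y
    proof -
      have "x = y + (x - y)"
        using x y by (intro eq_vecI) auto
      then have "nrm x \<le> nrm y + nrm (x - y)"
        using vec_norm_triangle[OF nrm, of y "x - y"] x y by simp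
      then show ?thesis
        using y vec_norm_minus_commute[OF nrm x(1) y(1)] by simp
    qed
    then show "\<exists>r>0. \<forall>y\<in>space (vec_borel d). nrm (y - x) < r \<longrightarrow>
        y \<in> {x \<in> space (vec_borel d). a < nrm x}"
      using x by (intro exI[of _ "nrm x - a"]) auto
  qed auto
qed

lemma measurable_vec_norm_diff [measurable (raw)]:
  assumes nrm: "is_vec_norm d nrm"
    and g: "g \<in> measurable M (vec_borel d)" "h \<in> measurable M (vec_borel d)"
  shows "(\<lambda>x. nrm (g x - h x)) \<in> borel_measurable M"
proof (rule measurable_compose[OF _ measurable_vec_norm[OF nrm]], rule measurable_vec_borelI)
  have car: "g x \<in> carrier_vec d" "h x \<in> carrier_vec d" if "x \<in> space M" for x
    using g[THEN measurable_space, OF that] by auto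
  show "g x - h x \<in> carrier_vec d" if "x \<in> space M" for x
    using car[OF that] by simp
  fix i assume i: "i < d"
  have "(\<lambda>x. vec_index (g x) i - vec_index (h x) i) \<in> borel_measurable M"
    using g[THEN measurable_compose, OF measurable_vec_index[OF i]] by measurable
  moreover have "vec_index (g x - h x) i = vec_index (g x) i - vec_index (h x) i"
    if "x \<in> space M" for x
    using car(2)[OF that] i by simp
  ultimately show "(\<lambda>x. vec_index (g x - h x) i) \<in> borel_measurable M"
    by (simp cong: measurable_cong)
qed

section \<open>Wasserstein balls around point masses\<close>

lemma AE_supported_on:
  assumes "prob_space Q" "supported_on Q S"
  shows "AE x in Q. x \<in> S"
  using prob_space.AE_in_set_eq_1[OF assms(1), of S] assms
  by (simp add: supported_on_def measure_def)

text \<open>In a coupling with a point mass the first coordinate equals \<open>x\<close> almost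
  everywhere, so all couplings have the same transport cost and the infimum is that common
  value.\<close>

lemma wasserstein_return:
  assumes nrm: "is_vec_norm d nrm" and S: "S \<in> sets (vec_borel d)" and x: "x \<in> S"
    and Q: "prob_space Q" "sets Q = sets (vec_borel d)" "supported_on Q S"
  shows "wasserstein d nrm S (return (vec_borel d) x) Q = (\<integral>\<^sup>+ \<xi>. ennreal (nrm (x - \<xi>)) \<partial>Q)"
proof -
  let ?B = "vec_borel d"
  interpret Q: prob_space Q by fact
  note [measurable_cong] = Q(2)
  have xc: "x \<in> space ?B"
    using sets.sets_into_space[OF S] x by blast
  have "(\<integral>\<^sup>+ z \<in> S \<times> S. ennreal (nrm (fst z - snd z)) \<partial>\<gamma>) = (\<integral>\<^sup>+ \<xi>. ennreal (nrm (x - \<xi>)) \<partial>Q)"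
    if \<gamma>: "\<gamma> \<in> couplings d (return ?B x) Q" for \<gamma>
  proof -
    have \<gamma>s [measurable_cong]: "sets \<gamma> = sets (?B \<Otimes>\<^sub>M ?B)"
      and \<gamma>1: "distr \<gamma> ?B fst = return ?B x" and \<gamma>2: "distr \<gamma> ?B snd = Q"
      using \<gamma> by (auto simp: couplings_def)
    have m: "fst \<in> measurable \<gamma> ?B" "snd \<in> measurable \<gamma> ?B"
      by measurable
    \<comment> \<open>The singleton at \<open>x\<close> is described by
      \<open>nrm (y - x) = 0\<close>, whose measurability comes from that of the norm.\<close>
    have "(\<lambda>y. nrm (y - x)) \<in> borel_measurable ?B"
      using xc by (intro measurable_vec_norm_diff[OF nrm]) auto
    then have "Measurable.pred ?B (\<lambda>y. nrm (y - x) = 0)"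
      by measurable
    moreover have "nrm (x - x) = 0"
      using xc vec_norm_zero[OF nrm] by simp
    ultimately have "AE y in distr \<gamma> ?B fst. nrm (y - x) = 0"
      unfolding \<gamma>1 using AE_return[OF xc] by blast
    then have "AE z in \<gamma>. nrm (fst z - x) = 0"
      by (rule AE_distrD[OF m(1)])
    moreover have "AE y in distr \<gamma> ?B snd. y \<in> S"
      unfolding \<gamma>2 by (rule AE_supported_on[OF Q(1,3)])
    then have "AE z in \<gamma>. snd z \<in> S"
      by (rule AE_distrD[OF m(2)])
    ultimately have "AE z in \<gamma>. z \<in> S \<times> S \<and> fst z = x"
    proof (rule AE_mp[OF AE_conjI AE_I2], intro impI)
      fix z assume z: "z \<in> space \<gamma>" "nrm (fst z - x) = 0 \<and> snd z \<in> S"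
      have fz: "fst z \<in> carrier_vec d"
        using measurable_space[OF m(1) z(1)] by simp
      have "fst z - x = 0\<^sub>v d"
        using nrm z fz xc by (auto simp: is_vec_norm_def)
      then have "vec_index (fst z - x) i = 0" if "i < d" for i
        using that by simp
      then have "fst z = x"
        using fz xc by (intro eq_vecI) auto
      then show "z \<in> S \<times> S \<and> fst z = x"
        using z x by (auto simp: mem_Times_iff)
    qed
    then have "(\<integral>\<^sup>+ z \<in> S \<times> S. ennreal (nrm (fst z - snd z)) \<partial>\<gamma>) =
        (\<integral>\<^sup>+ z. ennreal (nrm (x - snd z)) \<partial>\<gamma>)"
      by (intro nn_integral_cong_AE) auto
    also have "\<dots> = (\<integral>\<^sup>+ \<xi>. ennreal (nrm (x - \<xi>)) \<partial>distr \<gamma> ?B snd)"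
      using xc by (intro nn_integral_distr[symmetric] m measurable_compose[OF _ measurable_ennreal]
          measurable_vec_norm_diff[OF nrm]) auto
    finally show ?thesis
      by (simp add: \<gamma>2)
  qed
  \<comment> \<open>A coupling must be exhibited, since the infimum over the empty set would be
    infinite. The image of \<open>Q\<close> under pairing with the constant \<open>x\<close> is
    one.\<close>
  moreover have "couplings d (return ?B x) Q \<noteq> {}"
  proof -
    let ?\<gamma> = "distr Q (?B \<Otimes>\<^sub>M ?B) (\<lambda>\<xi>. (x, \<xi>))"
    have m: "(\<lambda>\<xi>. (x, \<xi>)) \<in> measurable Q (?B \<Otimes>\<^sub>M ?B)"
      using xc by measurable
    have "distr ?\<gamma> ?B fst = return ?B x" "distr ?\<gamma> ?B snd = Q"
      unfolding distr_distr[OF measurable_fst m] distr_distr[OF measurable_snd m]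
      using Q.distr_const[OF xc] distr_id2[OF Q(2)[symmetric]]
      by (simp_all only: comp_def fst_conv snd_conv)
    then have "?\<gamma> \<in> couplings d (return ?B x) Q"
      by (simp add: couplings_def)
    then show ?thesis
      by blast
  qed
  ultimately show ?thesis
    unfolding wasserstein_def by (intro INF_eq_const) auto
qed

lemma mem_wasserstein_ball_return:
  assumes "is_vec_norm d nrm" "S \<in> sets (vec_borel d)" "x \<in> S"
  shows "Q \<in> wasserstein_ball d nrm S \<epsilon> (return (vec_borel d) x) \<longleftrightarrow>
    Q \<in> finite_moment_distributions d nrm S \<and>
    (\<integral>\<^sup>+ \<xi>. ennreal (nrm (x - \<xi>)) \<partial>Q) \<le> ennreal \<epsilon>"
  using wasserstein_return[OF assms]
  by (auto simp: wasserstein_ball_def finite_moment_distributions_def)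

section \<open>Mixtures with a point mass and semicontinuity in the centre\<close>

text \<open>The mixture of \<open>Q\<close> and the point mass at \<open>x\<close> with weights
  \<open>1 - t\<close> and \<open>t\<close> is realized by a coin: with probability \<open>t\<close>
  return \<open>x\<close>, otherwise a sample of \<open>Q\<close>. As an image of a product measure
  it is a probability measure at once.\<close>

lemma obtain_mixture_with_point_mass:
  assumes "prob_space Q" and x: "x \<in> space Q" and t: "0 \<le> t" "t \<le> 1"
  obtains Q' where "prob_space Q'" "sets Q' = sets Q"
    "\<And>g. g \<in> borel_measurable Q \<Longrightarrow>
      (\<integral>\<^sup>+ \<xi>. g \<xi> \<partial>Q') = ennreal (1 - t) * (\<integral>\<^sup>+ \<xi>. g \<xi> \<partial>Q) + ennreal t * g x"
proof
  interpret Q: prob_space Q by fact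
  let ?b = "measure_pmf (bernoulli_pmf t)"
  let ?m = "\<lambda>z. if fst z then x else snd z"
  interpret b: prob_space ?b by (rule prob_space_measure_pmf)
  interpret bQ: pair_prob_space ?b Q ..
  have m [measurable]: "?m \<in> measurable (?b \<Otimes>\<^sub>M Q) Q"
    using x by measurable
  let ?Q = "distr (?b \<Otimes>\<^sub>M Q) Q ?m"
  show "prob_space ?Q"
    by (rule bQ.prob_space_distr[OF m])
  show "sets ?Q = sets Q"
    by simp
  fix g :: "'a \<Rightarrow> ennreal" assume g [measurable]: "g \<in> borel_measurable Q"
  have "(\<integral>\<^sup>+ \<xi>. g \<xi> \<partial>?Q) = (\<integral>\<^sup>+ z. g (?m z) \<partial>(?b \<Otimes>\<^sub>M Q))"
    by (rule nn_integral_distr) measurable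
  also have "\<dots> = (\<integral>\<^sup>+ b. \<integral>\<^sup>+ \<xi>. g (?m (b, \<xi>)) \<partial>Q \<partial>?b)"
    by (rule Q.nn_integral_fst[symmetric]) measurable
  also have "\<dots> = ennreal (1 - t) * (\<integral>\<^sup>+ \<xi>. g \<xi> \<partial>Q) + ennreal t * g x"
    using t by (simp add: nn_integral_bernoulli_pmf Q.emeasure_space_1 mult.commute add.commute)
  finally show "(\<integral>\<^sup>+ \<xi>. g \<xi> \<partial>?Q) = ennreal (1 - t) * (\<integral>\<^sup>+ \<xi>. g \<xi> \<partial>Q) + ennreal t * g x" .
qed

text \<open>Here \<open>a\<close> and \<open>b\<close> stand for the integrals of the positive and
  negative parts of a function, and \<open>w\<close> for its value at the added atom. A strict lower
  bound on the expectation survives a small enough weight of the atom, also when the expectation is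
  infinite.\<close>

lemma ereal_diff_mixture_greater:
  fixes a b :: ennreal and \<alpha> :: ereal and w :: real
  assumes fin: "a < \<infinity> \<or> b < \<infinity>" and less: "\<alpha> < enn2ereal a - enn2ereal b"
  obtains t :: real where "0 < t" "t < 1"
    "\<alpha> < enn2ereal (ennreal (1 - t) * a + ennreal t * ennreal w)
        - enn2ereal (ennreal (1 - t) * b + ennreal t * ennreal (- w))"
proof -
  \<comment> \<open>Since \<open>ennreal\<close> sends negative reals to 0, the atom contributes
    \<open>max 0 s\<close>.\<close>
  have mix: "enn2ereal (ennreal (1 - t) * ennreal r + ennreal t * ennreal s) =
      ereal ((1 - t) * r + t * max 0 s)" if "0 < t" "t < 1" "0 \<le> r" for t r s :: real
  proof -
    have "ennreal s = ennreal (max 0 s)"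
      by (simp add: max_def ennreal_neg)
    then have "ennreal (1 - t) * ennreal r + ennreal t * ennreal s =
        ennreal ((1 - t) * r + t * max 0 s)"
      using that by (simp add: ennreal_mult ennreal_plus)
    then show ?thesis
      using that by (simp del: ennreal_plus)
  qed
  show thesis
  proof (cases a)
    case top
    then obtain b' where b: "b = ennreal b'" "0 \<le> b'"
      using fin by (cases b) auto
    \<comment> \<open>An infinite positive part stays infinite after mixing and the negative part is
      finite, so any weight strictly between 0 and 1 serves.\<close>
    define t :: real where "t = 1 / 2"
    have t: "0 < t" "t < 1"
      by (simp_all add: t_def)
    have inf: "ennreal (1 - t) * a + ennreal t * ennreal w = \<infinity>"
      using top t by (simp add: ennreal_mult_top)
    have "\<alpha> < \<infinity>"
      using less by auto
    then show thesis
      by (intro that[OF t]) (simp only: inf b(1) mix[OF t b(2)], simp)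
  next
    case (real a')
    \<comment> \<open>With \<open>a\<close> finite, an infinite \<open>b\<close> would make the
      difference \<open>-\<infinity>\<close>, which cannot exceed \<open>\<alpha>\<close>.\<close>
    obtain b' where b: "b = ennreal b'" "0 \<le> b'"
      using less real by (cases b) (auto simp: enn2ereal_ennreal)
    have "\<alpha> < ereal (a' - b')"
      using less real b by (simp add: enn2ereal_ennreal)
    \<comment> \<open>A real \<open>z\<close> in between replaces \<open>\<alpha>\<close>, which may
      be \<open>-\<infinity>\<close>, so that the limit as \<open>t\<close> tends to 0 can be taken
      in the reals.\<close>
    then obtain z where z: "\<alpha> < ereal z" "z < a' - b'"
      using ereal_dense2[of \<alpha> "ereal (a' - b')"] by auto
    have "((\<lambda>t. (1 - t) * (a' - b') + t * w) \<longlongrightarrow> (1 - 0) * (a' - b') + 0 * w) (at_right 0)"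
      by (intro tendsto_intros)
    then have "\<forall>\<^sub>F t in at_right 0. z < (1 - t) * (a' - b') + t * w"
      using z(2) by (intro order_tendstoD) auto
    moreover have "\<forall>\<^sub>F t in at_right (0 :: real). t \<in> {0<..<1}"
      by (rule eventually_at_right_real) simp
    ultimately have "\<forall>\<^sub>F t in at_right 0. z < (1 - t) * (a' - b') + t * w \<and> t \<in> {0<..<1}"
      by (rule eventually_conj)
    then obtain t where t: "z < (1 - t) * (a' - b') + t * w" "0 < t" "t < 1"
      by (auto dest!: eventually_happens'[OF trivial_limit_at_right_real])
    have "(1 - t) * (a' - b') + t * w =
        ((1 - t) * a' + t * max 0 w) - ((1 - t) * b' + t * max 0 (- w))"
      by (auto simp: max_def algebra_simps)
    then have "ereal z < ereal (((1 - t) * a' + t * max 0 w) - ((1 - t) * b' + t * max 0 (- w)))"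
      using t(1) by simp
    with z(1) have "\<alpha> < ereal (((1 - t) * a' + t * max 0 w) - ((1 - t) * b' + t * max 0 (- w)))"
      by (rule less_trans)
    then show thesis
      by (intro that[OF t(2,3)])
        (simp only: real(2) b(1) mix[OF t(2,3) real(1)] mix[OF t(2,3) b(2)] ereal_minus)
  qed
qed

text \<open>Moving a little mass of \<open>Q\<close> to the centre \<open>x\<close> puts \<open>Q\<close> strictly inside the ball, hence in the
  balls around all nearby centres, at an arbitrarily small loss of expectation.\<close>

lemma wasserstein_ball_sup_lower_semicontinuous:
  assumes nrm: "is_vec_norm d nrm" and S: "S \<in> sets (vec_borel d)" and \<epsilon>: "0 < \<epsilon>"
    and g: "g \<in> borel_measurable (vec_borel d)"
    and wd: "\<And>Q. Q \<in> finite_moment_distributions d nrm S \<Longrightarrow> expectation_defined Q g"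
    and x: "x \<in> S"
    and less: "\<alpha> < (SUP Q \<in> wasserstein_ball d nrm S \<epsilon> (return (vec_borel d) x). ext_expectation Q g)"
  shows "\<exists>r>0. \<forall>y\<in>S. nrm (y - x) < r \<longrightarrow>
    \<alpha> < (SUP Q \<in> wasserstein_ball d nrm S \<epsilon> (return (vec_borel d) y). ext_expectation Q g)"
proof -
  let ?B = "vec_borel d"
  have Sc [simp]: "y \<in> carrier_vec d" if "y \<in> S" for y
    using sets.sets_into_space[OF S] that by auto
  note [measurable] = g measurable_vec_norm[OF nrm] S
  obtain Q where "Q \<in> wasserstein_ball d nrm S \<epsilon> (return ?B x)" and Q\<alpha>: "\<alpha> < ext_expectation Q g"
    using less unfolding less_SUP_iff by blast
  then have Q: "Q \<in> finite_moment_distributions d nrm S"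
    and Q\<epsilon>: "(\<integral>\<^sup>+ \<xi>. ennreal (nrm (x - \<xi>)) \<partial>Q) \<le> ennreal \<epsilon>"
    using mem_wasserstein_ball_return[OF nrm S x] by blast+
  then have Qp: "prob_space Q" and Qs [measurable_cong]: "sets Q = sets ?B"
    and QS: "supported_on Q S" and Qm: "(\<integral>\<^sup>+ \<xi>. ennreal (nrm \<xi>) \<partial>Q) < \<infinity>"
    by (auto simp: finite_moment_distributions_def)
  have spQ: "space Q = carrier_vec d"
    using sets_eq_imp_space_eq[OF Qs] by simp
  have xQ: "x \<in> space Q"
    using spQ x by simp
  obtain t where t: "0 < t" "t < 1"
    and t\<alpha>: "\<alpha> < enn2ereal (ennreal (1 - t) * (\<integral>\<^sup>+ \<xi>. ennreal (g \<xi>) \<partial>Q) + ennreal t * ennreal (g x))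
      - enn2ereal (ennreal (1 - t) * (\<integral>\<^sup>+ \<xi>. ennreal (- g \<xi>) \<partial>Q) + ennreal t * ennreal (- g x))"
    using ereal_diff_mixture_greater[of _ _ \<alpha> "g x"] wd[OF Q] Q\<alpha>
    unfolding expectation_defined_def ext_expectation_def by blast
  obtain Q' where Q'p: "prob_space Q'" and Q's: "sets Q' = sets Q"
    and Q'i: "\<And>h. h \<in> borel_measurable Q \<Longrightarrow>
      (\<integral>\<^sup>+ \<xi>. h \<xi> \<partial>Q') = ennreal (1 - t) * (\<integral>\<^sup>+ \<xi>. h \<xi> \<partial>Q) + ennreal t * h x"
    using obtain_mixture_with_point_mass[OF Qp xQ, of t] t by auto
  note [measurable_cong] = Q's
  have Q'\<alpha>: "\<alpha> < ext_expectation Q' g"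
    unfolding ext_expectation_def using t\<alpha> by (simp add: Q'i)
  have "emeasure Q' S = 1"
  proof -
    have "emeasure Q' S = (\<integral>\<^sup>+ \<xi>. indicator S \<xi> \<partial>Q')"
      using S Q's Qs by simp
    also have "\<dots> = ennreal (1 - t) * (\<integral>\<^sup>+ \<xi>. indicator S \<xi> \<partial>Q) + ennreal t * indicator S x"
      by (rule Q'i) measurable
    also have "\<dots> = 1"
      using QS x t S Qs by (simp add: supported_on_def ennreal_plus[symmetric] del: ennreal_plus)
    finally show ?thesis .
  qed
  moreover have "(\<integral>\<^sup>+ \<xi>. ennreal (nrm \<xi>) \<partial>Q') < \<infinity>"
    using Qm by (simp add: Q'i ennreal_mult_less_top)
  ultimately have Q': "Q' \<in> finite_moment_distributions d nrm S"
    using Q'p Q's Qs S by (simp add: finite_moment_distributions_def supported_on_def)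
  have diff [measurable]: "(\<lambda>\<xi>. ennreal (nrm (y - \<xi>))) \<in> borel_measurable Q" if "y \<in> S" for y
    using that by (intro measurable_compose[OF _ measurable_ennreal]
        measurable_vec_norm_diff[OF nrm]) auto
  have "nrm (x - x) = 0"
    using Sc[OF x] vec_norm_zero[OF nrm] by auto
  \<comment> \<open>The mass already at the centre costs nothing to transport, which shrinks the
    cost by the factor \<open>1 - t\<close>.\<close>
  then have "(\<integral>\<^sup>+ \<xi>. ennreal (nrm (x - \<xi>)) \<partial>Q') =
      ennreal (1 - t) * (\<integral>\<^sup>+ \<xi>. ennreal (nrm (x - \<xi>)) \<partial>Q)"
    using x by (simp add: Q'i diff)
  also have "\<dots> \<le> ennreal (1 - t) * ennreal \<epsilon>"
    using Q\<epsilon> by (intro mult_left_mono) auto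
  also have "\<dots> = ennreal ((1 - t) * \<epsilon>)"
    using t \<epsilon> by (simp add: ennreal_mult)
  finally have Q'\<epsilon>: "(\<integral>\<^sup>+ \<xi>. ennreal (nrm (x - \<xi>)) \<partial>Q') \<le> ennreal ((1 - t) * \<epsilon>)" .
  \<comment> \<open>The slack \<open>t * \<epsilon>\<close> gained by mixing pays for moving the
    centre from \<open>x\<close> to \<open>y\<close>.\<close>
  have "\<alpha> < (SUP Q \<in> wasserstein_ball d nrm S \<epsilon> (return ?B y). ext_expectation Q g)"
    if y: "y \<in> S" "nrm (y - x) < t * \<epsilon>" for y
  proof -
    interpret Q': prob_space Q' by fact
    have nn: "0 \<le> nrm (y - x)"
      using x y by (intro vec_norm_nonneg[OF nrm]) simp
    have "(\<integral>\<^sup>+ \<xi>. ennreal (nrm (y - \<xi>)) \<partial>Q') \<le>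
        (\<integral>\<^sup>+ \<xi>. ennreal (nrm (y - x)) + ennreal (nrm (x - \<xi>)) \<partial>Q')"
    proof (rule nn_integral_mono)
      fix \<xi> assume "\<xi> \<in> space Q'"
      then have \<xi>: "\<xi> \<in> carrier_vec d"
        using sets_eq_imp_space_eq[OF Q's] spQ by simp
      have "nrm (y - \<xi>) \<le> nrm (y - x) + nrm (x - \<xi>)"
        using x y \<xi> by (intro vec_norm_dist_triangle[OF nrm]) auto
      moreover have "0 \<le> nrm (x - \<xi>)"
        using x \<xi> by (intro vec_norm_nonneg[OF nrm]) auto
      ultimately show "ennreal (nrm (y - \<xi>)) \<le> ennreal (nrm (y - x)) + ennreal (nrm (x - \<xi>))"
        using nn by (simp add: ennreal_plus[symmetric] ennreal_leI del: ennreal_plus)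
    qed
    also have "\<dots> = ennreal (nrm (y - x)) + (\<integral>\<^sup>+ \<xi>. ennreal (nrm (x - \<xi>)) \<partial>Q')"
      using diff[OF x] by (subst nn_integral_add) (auto simp: Q'.emeasure_space_1)
    also have "\<dots> \<le> ennreal (t * \<epsilon>) + ennreal ((1 - t) * \<epsilon>)"
      using y(2) by (intro add_mono Q'\<epsilon> ennreal_leI) simp
    also have "\<dots> = ennreal \<epsilon>"
      using t \<epsilon> by (simp add: ennreal_plus[symmetric] algebra_simps del: ennreal_plus)
    finally have "Q' \<in> wasserstein_ball d nrm S \<epsilon> (return ?B y)"
      using Q' mem_wasserstein_ball_return[OF nrm S y(1)] by blast
    then show ?thesis
      using Q'\<alpha> unfolding less_SUP_iff by blast
  qed
  then show ?thesis
    using mult_pos_pos[OF t(1) \<epsilon>] by blast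
qed

text \<open>By lower semicontinuity the strict superlevel sets of the supremum are relatively open
  in \<open>S\<close>, so it is Borel on \<open>S\<close>, and then so are its non-strict superlevel
  sets. The restricted space is used because semicontinuity concerns centres in \<open>S\<close>
  only.\<close>

lemma sets_wasserstein_ball_sup_ge:
  assumes nrm: "is_vec_norm d nrm" and S: "S \<in> sets (vec_borel d)" and \<epsilon>: "0 < \<epsilon>"
    and g: "g \<in> borel_measurable (vec_borel d)"
    and wd: "\<And>Q. Q \<in> finite_moment_distributions d nrm S \<Longrightarrow> expectation_defined Q g"
  shows "{x \<in> S. \<alpha> \<le> (SUP Q \<in> wasserstein_ball d nrm S \<epsilon> (return (vec_borel d) x).
    ext_expectation Q g)} \<in> sets (vec_borel d)"
proof -
  let ?\<phi> = "\<lambda>x. SUP Q \<in> wasserstein_ball d nrm S \<epsilon> (return (vec_borel d) x). ext_expectation Q g"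
  let ?R = "restrict_space (vec_borel d) S"
  have sp: "space ?R = S"
    using sets.sets_into_space[OF S] by (auto simp: space_restrict_space)
  have SB: "S \<inter> space (vec_borel d) \<in> sets (vec_borel d)"
    using S by (rule sets.Int) (rule sets.top)
  have "?\<phi> \<in> borel_measurable ?R"
  proof (rule borel_measurableI_greater)
    fix z
    have "{x \<in> S. z < ?\<phi> x} \<in> sets (vec_borel d)"
    proof (rule sets_vec_borel_relatively_norm_open[OF nrm S])
      fix x assume "x \<in> {x \<in> S. z < ?\<phi> x}"
      then show "\<exists>r>0. \<forall>y\<in>S. nrm (y - x) < r \<longrightarrow> y \<in> {x \<in> S. z < ?\<phi> x}"
        using wasserstein_ball_sup_lower_semicontinuous[OF nrm S \<epsilon> g wd, of x z] by auto
    qed auto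
    then show "{x \<in> space ?R. z < ?\<phi> x} \<in> sets ?R"
      unfolding sp by (subst sets_restrict_space_iff[OF SB]) auto
  qed
  then have "{x \<in> space ?R. \<alpha> \<le> ?\<phi> x} \<in> sets ?R"
    by measurable
  then show ?thesis
    unfolding sp by (subst (asm) sets_restrict_space_iff[OF SB]) auto
qed

section \<open>Coverage of the true distribution by a random ball\<close>

text \<open>For a centre \<open>x\<close> in \<open>S\<close> with \<open>nrm x < K\<close>, the
  transport cost to \<open>P\<close> is at most \<open>K\<close> plus the mean norm; Markov's
  inequality makes such centres likely. The set \<open>G\<close> of good centres depends on no cost
  function.\<close>

lemma wasserstein_ball_contains_with_high_probability:
  assumes nrm: "is_vec_norm d nrm" and S: "S \<in> sets (vec_borel d)"
    and P: "P \<in> finite_moment_distributions d nrm S" and \<beta>: "0 < \<beta>"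
  obtains \<epsilon> G where "0 < \<epsilon>" "G \<in> sets (vec_borel d)" "G \<subseteq> S" "1 - \<beta> \<le> measure P G"
    "\<And>x. x \<in> G \<Longrightarrow> P \<in> wasserstein_ball d nrm S \<epsilon> (return (vec_borel d) x)"
proof -
  have Pp: "prob_space P" and Ps [measurable_cong]: "sets P = sets (vec_borel d)"
    and PS: "supported_on P S" and Pm: "(\<integral>\<^sup>+ \<xi>. ennreal (nrm \<xi>) \<partial>P) < \<infinity>"
    using P by (auto simp: finite_moment_distributions_def)
  interpret P: prob_space P by fact
  note [measurable] = measurable_vec_norm[OF nrm] S
  have spP: "space P = carrier_vec d"
    using sets_eq_imp_space_eq[OF Ps] by simp
  have Sc: "S \<subseteq> carrier_vec d"
    using sets.sets_into_space[OF S] by simp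
  have nn: "0 \<le> nrm x" if "x \<in> space P" for x
    using vec_norm_nonneg[OF nrm] that spP by simp
  have int: "integrable P nrm"
    using Pm nn by (intro integrableI_nonneg) auto
  define m where "m = (\<integral>\<xi>. nrm \<xi> \<partial>P)"
  have m: "0 \<le> m"
    unfolding m_def using nn by (intro Bochner_Integration.integral_nonneg_AE AE_I2)
  have mi: "(\<integral>\<^sup>+ \<xi>. ennreal (nrm \<xi>) \<partial>P) = ennreal m"
    unfolding m_def using nn by (intro nn_integral_eq_integral[OF int]) auto
  \<comment> \<open>Markov's bound becomes \<open>m / K = \<beta> * m / (m + 1)\<close>, at most
    \<open>\<beta>\<close>; the summand 1 keeps \<open>K\<close> positive when
    \<open>m = 0\<close>.\<close>
  define K where "K = (m + 1) / \<beta>"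
  have K: "0 < K"
    using m \<beta> by (simp add: K_def)
  define G where "G = {x \<in> S. nrm x < K}"
  have Gs: "G \<in> sets (vec_borel d)"
  proof -
    have "{x \<in> space (vec_borel d). x \<in> S \<and> nrm x < K} \<in> sets (vec_borel d)"
      by measurable
    moreover have "G = {x \<in> space (vec_borel d). x \<in> S \<and> nrm x < K}"
      using Sc by (auto simp: G_def)
    ultimately show ?thesis
      by simp
  qed
  have "P.prob {x \<in> space P. K \<le> nrm x} \<le> m / K"
    unfolding m_def
    by (rule integral_Markov_inequality_measure[OF int sets.empty_sets _ K]) (use nn in auto)
  also have "\<dots> \<le> \<beta>"
    using m \<beta> by (simp add: K_def field_simps)
  finally have tail: "P.prob {x \<in> space P. K \<le> nrm x} \<le> \<beta>" .
  have "1 - P.prob {x \<in> space P. K \<le> nrm x} = P.prob (space P - {x \<in> space P. K \<le> nrm x})"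
    by (rule P.prob_compl[symmetric]) measurable
  \<comment> \<open>The two sets differ only outside \<open>S\<close>, that is, on a null
    set.\<close>
  also have "\<dots> = P.prob G"
  proof (rule P.finite_measure_eq_AE)
    show "AE x in P. x \<in> space P - {x \<in> space P. K \<le> nrm x} \<longleftrightarrow> x \<in> G"
      using AE_supported_on[OF Pp PS] AE_space by eventually_elim (auto simp: G_def)
    show "space P - {x \<in> space P. K \<le> nrm x} \<in> P.events"
      by measurable
    show "G \<in> P.events"
      using Gs Ps by simp
  qed
  finally have GP: "1 - \<beta> \<le> P.prob G"
    using tail by simp
  have "P \<in> wasserstein_ball d nrm S (K + m) (return (vec_borel d) x)" if x: "x \<in> G" for x
  proof -
    have xS: "x \<in> S" "nrm x < K" "x \<in> carrier_vec d"
      using x Sc by (auto simp: G_def)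
    have nx: "0 \<le> nrm x"
      using nn xS(3) spP by simp
    have "(\<integral>\<^sup>+ \<xi>. ennreal (nrm (x - \<xi>)) \<partial>P) \<le> (\<integral>\<^sup>+ \<xi>. ennreal (nrm x) + ennreal (nrm \<xi>) \<partial>P)"
    proof (rule nn_integral_mono)
      fix \<xi> assume \<xi>: "\<xi> \<in> space P"
      then have "nrm (x - \<xi>) \<le> nrm x + nrm \<xi>"
        using vec_norm_diff_le[OF nrm xS(3)] spP by simp
      then show "ennreal (nrm (x - \<xi>)) \<le> ennreal (nrm x) + ennreal (nrm \<xi>)"
        using nn[OF \<xi>] nx by (simp add: ennreal_plus[symmetric] ennreal_leI del: ennreal_plus)
    qed
    also have "\<dots> = ennreal (nrm x) + ennreal m"
      by (subst nn_integral_add) (auto simp: P.emeasure_space_1 mi)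
    also have "\<dots> \<le> ennreal (K + m)"
      using xS(2) nx m by (simp add: ennreal_plus[symmetric] ennreal_leI del: ennreal_plus)
    finally show ?thesis
      using P mem_wasserstein_ball_return[OF nrm S xS(1)] by blast
  qed
  then show ?thesis
    using that[of "K + m" G] K m Gs GP by (auto simp: G_def)
qed

section \<open>The product distribution\<close>

text \<open>Whatever \<open>g\<close> is, \<open>distr\<close> gives a set either the measure of its
  preimage or 0, so the total mass is at most 1; the support supplies the reverse bound. Thus the
  row distributions are probability measures by their support condition alone.\<close>

lemma prob_space_distr_of_supported_on:
  assumes "prob_space M" and "supported_on (distr M N g) S"
  shows "prob_space (distr M N g)"
proof (rule prob_spaceI, rule antisym)
  show "emeasure (distr M N g) (space (distr M N g)) \<le> 1"
    using prob_space.emeasure_le_1[OF assms(1)]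
    by (auto simp: distr_def emeasure_measure_of_conv)
  show "1 \<le> emeasure (distr M N g) (space (distr M N g))"
    using assms(2) emeasure_space[of "distr M N g" S] by (simp add: supported_on_def)
qed

lemma measurable_row_block:
  assumes "j < R"
  shows "(\<lambda>\<xi>. row_block N \<xi> j) \<in> measurable (vec_borel (R * N)) (vec_borel N)"
proof (rule measurable_vec_borelI)
  fix k assume k: "k < N"
  have "j * N + k < Suc j * N"
    using k by simp
  also have "\<dots> \<le> R * N"
    using assms by (intro mult_right_mono) auto
  finally show "(\<lambda>\<xi>. vec_index (row_block N \<xi> j) k) \<in> borel_measurable (vec_borel (R * N))"
    using k by (simp add: row_block_def measurable_vec_index)
qed (simp add: row_block_def)

lemma sets_product_support:
  assumes "\<And>j. j < R \<Longrightarrow> X j \<in> sets (vec_borel N)"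
  shows "product_support R N X \<in> sets (vec_borel (R * N))"
proof -
  have "{\<xi> \<in> space (vec_borel (R * N)). \<forall>j\<in>{..<R}. row_block N \<xi> j \<in> X j}
      \<in> sets (vec_borel (R * N))"
  proof (rule sets.sets_Collect_finite_All)
    fix j assume "j \<in> {..<R}"
    then have "(\<lambda>\<xi>. row_block N \<xi> j) -` X j \<inter> space (vec_borel (R * N))
        \<in> sets (vec_borel (R * N))"
      using assms by (intro measurable_sets[OF measurable_row_block]) auto
    then show "{\<xi> \<in> space (vec_borel (R * N)). row_block N \<xi> j \<in> X j}
        \<in> sets (vec_borel (R * N))"
      by (simp add: vimage_def Collect_conj_eq Int_commute)
  qed simp
  moreover have "product_support R N X =
      {\<xi> \<in> space (vec_borel (R * N)). \<forall>j\<in>{..<R}. row_block N \<xi> j \<in> X j}"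
    by (auto simp: product_support_def)
  ultimately show ?thesis
    by (simp only:)
qed

text \<open>Cutting the stacked vector into blocks returns the factors, and almost surely each of
  the finitely many factors lies in its own support.\<close>

lemma product_distribution:
  assumes prob: "\<And>j. j < R \<Longrightarrow> prob_space (Q j)"
    and sets: "\<And>j. j < R \<Longrightarrow> sets (Q j) = sets (vec_borel N)"
    and supp: "\<And>j. j < R \<Longrightarrow> supported_on (Q j) (X j)"
  shows "prob_space (product_distribution R N Q)"
    and "supported_on (product_distribution R N Q) (product_support R N X)"
proof -
  let ?B = "vec_borel (R * N)" and ?\<Pi> = "\<Pi>\<^sub>M j\<in>{..<R}. Q j"
  let ?s = "\<lambda>r. Matrix.vec (R * N) (\<lambda>i. vec_index (r (i div N)) (i mod N))"
  interpret \<Pi>: prob_space ?\<Pi>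
    using prob by (intro prob_space_PiM) auto
  have s: "?s \<in> measurable ?\<Pi> ?B"
  proof (rule measurable_vec_borelI)
    fix i assume i: "i < R * N"
    \<comment> \<open>The bound \<open>i < R * N\<close> also forces \<open>N\<close> to be
      positive, as the remainder needs.\<close>
    then have j: "i div N < R" and k: "i mod N < N"
      by (auto simp: less_mult_imp_div_less intro!: mod_less_divisor gr0I)
    have "(\<lambda>r. r (i div N)) \<in> measurable ?\<Pi> (vec_borel N)"
      using measurable_component_singleton[of "i div N" "{..<R}" Q] j
      by (simp add: measurable_cong_sets[OF refl sets[OF j]])
    from measurable_compose[OF this measurable_vec_index[OF k]]
    show "(\<lambda>r. vec_index (?s r) i) \<in> borel_measurable ?\<Pi>"
      using i by simp
  qed simp
  show prob': "prob_space (product_distribution R N Q)"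
    unfolding product_distribution_def by (rule \<Pi>.prob_space_distr[OF s])
  have S: "product_support R N X \<in> sets ?B"
    using supp sets by (intro sets_product_support) (auto simp: supported_on_def)
  \<comment> \<open>\<open>row_block\<close> undoes the stacking; the carrier condition matters
    because equal vectors need equal dimensions.\<close>
  have rows: "row_block N (?s r) j = r j" if "j < R" "r j \<in> carrier_vec N" for r j
  proof (rule eq_vecI)
    fix k assume "k < dim_vec (r j)"
    then have k: "k < N"
      using that by simp
    have "j * N + k < Suc j * N"
      using k by simp
    also have "\<dots> \<le> R * N"
      using that by (intro mult_right_mono) auto
    finally show "vec_index (row_block N (?s r) j) k = vec_index (r j) k"
      using k by (simp add: row_block_def)
  qed (use that in \<open>simp add: row_block_def\<close>)
  have "AE r in ?\<Pi>. \<forall>j\<in>{..<R}. r j \<in> X j"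
    using prob supp by (intro AE_finite_allI AE_PiM_component) (auto intro: AE_supported_on)
  moreover have "AE r in ?\<Pi>. r \<in> space ?\<Pi>"
    by simp
  ultimately have "AE r in ?\<Pi>. ?s r \<in> product_support R N X"
  proof eventually_elim
    case (elim r)
    have "r j \<in> carrier_vec N" if "j < R" for j
      using elim(2) that sets_eq_imp_space_eq[OF sets[OF that]] by (auto simp: space_PiM PiE_iff)
    then show ?case
      using elim(1) rows by (auto simp: product_support_def)
  qed
  then have "AE \<xi> in product_distribution R N Q. \<xi> \<in> product_support R N X"
    unfolding product_distribution_def using S sets.sets_into_space[OF S]
    by (subst AE_distr_iff[OF s]) (auto simp: Int_absorb1 Collect_conj_eq)
  then show "supported_on (product_distribution R N Q) (product_support R N X)"
    using S prob_space.emeasure_eq_1_AE[OF prob']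
    by (simp add: supported_on_def product_distribution_def)
qed

section \<open>First moment from the light tail\<close>

text \<open>Pointwise \<open>y \<le> 1 + exp (y powr a)\<close>: this is trivial for
  \<open>y \<le> 1\<close>, and beyond 1 both \<open>y \<le> y powr a\<close> and
  \<open>y powr a \<le> exp (y powr a)\<close> hold.\<close>

lemma nn_integral_finite_of_light_tailed:
  assumes "prob_space Q" and g: "g \<in> borel_measurable Q" and "1 \<le> a"
    and tail: "(\<integral>\<^sup>+ x. ennreal (exp (g x powr a)) \<partial>Q) < \<infinity>"
  shows "(\<integral>\<^sup>+ x. ennreal (g x) \<partial>Q) < \<infinity>"
proof -
  interpret Q: prob_space Q by fact
  note [measurable] = g
  have le: "y \<le> 1 + exp (y powr a)" for y :: real
  proof (cases "y \<le> 1")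
    case True
    then show ?thesis
      using exp_ge_zero[of "y powr a"] by linarith
  next
    case False
    then have "y powr 1 \<le> y powr a"
      using \<open>1 \<le> a\<close> by (intro powr_mono) auto
    then have "y \<le> y powr a"
      using False by simp
    then show ?thesis
      using exp_ge_add_one_self[of "y powr a"] by linarith
  qed
  have "(\<integral>\<^sup>+ x. ennreal (g x) \<partial>Q) \<le> (\<integral>\<^sup>+ x. 1 + ennreal (exp (g x powr a)) \<partial>Q)"
  proof (rule nn_integral_mono)
    fix x
    have "ennreal (g x) \<le> ennreal (1 + exp (g x powr a))"
      by (rule ennreal_leI[OF le])
    then show "ennreal (g x) \<le> 1 + ennreal (exp (g x powr a))"
      by simp
  qed
  also have "\<dots> = 1 + (\<integral>\<^sup>+ x. ennreal (exp (g x powr a)) \<partial>Q)"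
    by (subst nn_integral_add) (auto simp: Q.emeasure_space_1)
  also have "\<dots> < \<infinity>"
    using tail by (simp add: less_top[symmetric])
  finally show ?thesis .
qed

theorem mainTheorem1:
  fixes n m p q T Tini Tf N R :: nat
    and A B C D E F :: "real Matrix.mat"
    and Pv :: "real Matrix.vec measure"
    and M :: "'w measure"
    and u uini :: "nat \<Rightarrow> real Matrix.vec"
    and x v y xini vini yini :: "nat \<Rightarrow> 'w \<Rightarrow> real Matrix.vec"
    and Up Uf :: "real Matrix.mat"
    and \<Xi>row :: "nat \<Rightarrow> real Matrix.vec set"
    and \<Xi> :: "real Matrix.vec set"
    and P :: "real Matrix.vec measure"
    and U H :: "real Matrix.vec set"
    and f :: "real Matrix.vec \<Rightarrow> real Matrix.vec \<Rightarrow> real"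
    and c :: "real Matrix.vec \<Rightarrow> real Matrix.vec \<Rightarrow> real"
    and normW :: "real Matrix.vec \<Rightarrow> real"
    and lam \<beta> :: real
  assumes dims: "A \<in> carrier_mat n n" "B \<in> carrier_mat n m" "E \<in> carrier_mat n q"
      "C \<in> carrier_mat p n" "D \<in> carrier_mat p m" "F \<in> carrier_mat p q"
    and ctrb: "controllable n m A B"
    and obsv: "observable n p A C"
    and Pv: "prob_space Pv" "sets Pv = sets (vec_borel q)"
    and horizons: "0 < T" "0 < Tini" "0 < Tf" "lag n p A C \<le> Tini"
    and N: "N = T + 2 - (Tini + Tf)"
    and R: "R = (Tini + Tf) * p"
    and pe: "persistently_exciting m (Tini + Tf + n) T u"
    and M: "prob_space M"
    and data: "stochastic_trajectory M n m p q A B C D E F Pv T u x v y"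
    and recent: "stochastic_trajectory M n m p q A B C D E F Pv Tini uini xini vini yini"
    and Up: "Up = hankel_past m Tini Tf T u"
    and Uf: "Uf = hankel_future m Tini Tf T u"
    and supp: "\<And>j. j < R \<Longrightarrow>
      supported_on (row_distribution M N p Tini Tf T y yini j) (\<Xi>row j)"
    and \<Xi>: "\<Xi> = product_support R N \<Xi>row"
    and P: "P = product_distribution R N (row_distribution M N p Tini Tf T y yini)"
    and U: "U \<subseteq> carrier_vec (Tf * m)"
    and lam: "0 \<le> lam"
    and H: "H = decision_set N Up Uf (stack m Tini uini) U"
    and c: "c = cost f lam N p Tini Tf Uf"
    and normW: "is_vec_norm (R * N) normW"
    and well_defined: "\<And>h Q. h \<in> H \<Longrightarrow> Q \<in> finite_moment_distributions (R * N) normW \<Xi> \<Longrightarrow>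
      expectation_defined Q (\<lambda>\<xi>. c \<xi> h)"
    and light_tailed: "\<exists>a>1. (\<integral>\<^sup>+ \<xi>. ennreal (exp (normW \<xi> powr a)) \<partial>P) < \<infinity>"
    and \<beta>: "0 < \<beta>" "\<beta> < 1"
  shows "\<exists>\<epsilon>>0. \<forall>h\<in>H.
    measure P {\<xi>hat \<in> \<Xi>.
      ext_expectation P (\<lambda>\<xi>. c \<xi> h)
        \<le> (SUP Q \<in> wasserstein_ball (R * N) normW \<Xi> \<epsilon> (return (vec_borel (R * N)) \<xi>hat).
             ext_expectation Q (\<lambda>\<xi>. c \<xi> h))} \<ge> 1 - \<beta>"
proof -
  let ?B = "vec_borel (R * N)" and ?\<rho> = "row_distribution M N p Tini Tf T y yini"
  have sets_row: "sets (?\<rho> j) = sets (vec_borel N)" for j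
    by (simp add: row_distribution_def)
  have prob_row: "prob_space (?\<rho> j)" if "j < R" for j
    using supp[OF that] unfolding row_distribution_def
    by (rule prob_space_distr_of_supported_on[OF M])
  have P_prob: "prob_space P" and P_supp: "supported_on P \<Xi>"
    unfolding P \<Xi> using prob_row sets_row supp by (auto intro!: product_distribution)
  have P_sets: "sets P = sets ?B"
    by (simp add: P product_distribution_def)
  have \<Xi>_sets: "\<Xi> \<in> sets ?B"
    using P_supp P_sets by (simp add: supported_on_def)
  have "normW \<in> borel_measurable P"
    using measurable_vec_norm[OF normW] measurable_cong_sets[OF P_sets refl] by blast
  then have "(\<integral>\<^sup>+ \<xi>. ennreal (normW \<xi>) \<partial>P) < \<infinity>"
    using light_tailed nn_integral_finite_of_light_tailed[OF P_prob] by (metis less_imp_le)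
  then have P_mem: "P \<in> finite_moment_distributions (R * N) normW \<Xi>"
    using P_prob P_sets P_supp by (simp add: finite_moment_distributions_def)
  \<comment> \<open>Both \<open>\<epsilon>\<close> and \<open>G\<close> are fixed before any
    decision \<open>h\<close> is considered, so a single radius serves all of
    \<open>H\<close>.\<close>
  obtain \<epsilon> G where \<epsilon>: "0 < \<epsilon>" and G: "G \<in> sets ?B" "G \<subseteq> \<Xi>" "1 - \<beta> \<le> measure P G"
    and ball: "\<And>\<xi>. \<xi> \<in> G \<Longrightarrow> P \<in> wasserstein_ball (R * N) normW \<Xi> \<epsilon> (return ?B \<xi>)"
    using wasserstein_ball_contains_with_high_probability[OF normW \<Xi>_sets P_mem \<beta>(1)] by blast
  have "1 - \<beta> \<le> measure P {\<xi>hat \<in> \<Xi>. ext_expectation P (\<lambda>\<xi>. c \<xi> h)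
      \<le> (SUP Q \<in> wasserstein_ball (R * N) normW \<Xi> \<epsilon> (return ?B \<xi>hat).
           ext_expectation Q (\<lambda>\<xi>. c \<xi> h))}" (is "_ \<le> measure P ?E") if h: "h \<in> H" for h
  proof -
    have wd: "expectation_defined Q (\<lambda>\<xi>. c \<xi> h)"
      if "Q \<in> finite_moment_distributions (R * N) normW \<Xi>" for Q
      using well_defined[OF h that] .
    \<comment> \<open>Measurability of the cost is part of its expectation being defined, used here
      at \<open>P\<close> itself.\<close>
    then have "(\<lambda>\<xi>. c \<xi> h) \<in> borel_measurable P"
      using P_mem by (auto simp: expectation_defined_def)
    then have "(\<lambda>\<xi>. c \<xi> h) \<in> borel_measurable ?B"
      using measurable_cong_sets[OF P_sets refl] by blast
    then have "?E \<in> sets P"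
      unfolding P_sets by (rule sets_wasserstein_ball_sup_ge[OF normW \<Xi>_sets \<epsilon> _ wd])
    \<comment> \<open>On \<open>G\<close> the distribution \<open>P\<close> competes in the
      supremum, so its expectation is at most the supremum.\<close>
    moreover have "G \<subseteq> ?E"
      using G(2) ball by (auto intro: SUP_upper)
    ultimately show ?thesis
      using G(3) finite_measure.finite_measure_mono[OF prob_space.finite_measure[OF P_prob]]
      by (meson order_trans)
  qed
  then show ?thesis
    using \<epsilon> by blast
qed

end
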